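(* Let $k,p\ge 0$ be integers, let $d=k+p$, and let $n\ge d$ be an integer. Then the number of Dyck paths of semilength $n$ belonging to the class $\mathcal{D}_{k,p}$ (for $k,p\ge 1$ these are exactly the Dyck paths of semilength $n$ that begin with at least $k$ successive upsteps, end with at least $p$ successive downsteps, and touch the $x$-axis at least once somewhere between the endpoints) is equal to the number of Standard Young Tableaux of shape $(n,n-d)$.
   Context: A Dyck path of semilength $n$ is a lattice path from $(0,0)$ to $(2n,0)$ consisting of upsteps $(1,1)$ and downsteps $(1,-1)$ that never goes below the $x$-axis; the empty path is the Dyck path of semilength $0$. For integers $k,p\ge 0$, $\mathcal{P}_{k,p}$ is the class of all Dyck paths that start with at least $k$ upsteps and end with at least $p$ downsteps. The class $\mathcal{D}_{k,p}$ consists of all paths in $\mathcal{P}_{k,p}$ that are a concatenation of two or more Dyck paths (components) such that at least one of the components is of semilength at least $k$ and another (a different component) is of semilength at least $p$. Components are allowed to be empty (so when $k$ or $p$ is $0$ the path is not required to touch the $x$-axis between its endpoints). A Standard Young Tableau of shape $(n,n-d)$ consists of two left-justified rows of cells, a top row of $n$ cells and a bottom row of $n-d$ cells, filled with the numbers $1,2,\ldots,2n-d$, each used exactly once, so that the numbers increase strictly from left to right in each row and from top to bottom in each column. *)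

theory Defs
  imports Main "HOL-Library.Sublist"
begin

datatype step = Up | Down

text \<open>A lattice path from the origin is the list of its steps: after \<open>i\<close> steps it is at the
  point \<open>(i, height (take i w))\<close>.\<close>

type_synonym path = "step list"

fun rise :: "step \<Rightarrow> int" where
  "rise Up = 1"
| "rise Down = - 1"

definition height :: "path \<Rightarrow> int" where
  "height w = (\<Sum>s\<leftarrow>w. rise s)"

definition dyck :: "path \<Rightarrow> bool" where
  "dyck w \<longleftrightarrow> (\<forall>i\<le>length w. height (take i w) \<ge> 0) \<and> height w = 0"

definition semilength :: "path \<Rightarrow> nat" where
  "semilength w = length w div 2"

lemma even_height_iff: "even (height w) \<longleftrightarrow> even (length w)"
proof (induction w)
  case Nil
  then show ?case by (simp add: height_def)
next
  case (Cons s w)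
  then show ?case by (cases s) (simp_all add: height_def)
qed

text \<open>The division in \<open>semilength\<close> is exact on Dyck paths.\<close>

lemma length_dyck: "dyck w \<Longrightarrow> length w = 2 * semilength w"
  using even_height_iff[of w] by (simp add: dyck_def semilength_def)

definition P_class :: "nat \<Rightarrow> nat \<Rightarrow> path set" where
  "P_class k p = {w. dyck w \<and> prefix (replicate k Up) w \<and> suffix (replicate p Down) w}"

text \<open>The components \<open>cs\<close> may be empty and need not be prime (they may return to the axis
  in their interior); the two long components must sit at different positions of \<open>cs\<close>, but may
  be equal as paths.\<close>

definition D_class :: "nat \<Rightarrow> nat \<Rightarrow> path set" where
  "D_class k p = {w \<in> P_class k p. \<exists>cs. length cs \<ge> 2 \<and> (\<forall>c\<in>set cs. dyck c) \<and> w = concat cs \<and>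
     (\<exists>i<length cs. \<exists>j<length cs. i \<noteq> j \<and> semilength (cs ! i) \<ge> k \<and> semilength (cs ! j) \<ge> p)}"

definition touches_axis_inside :: "path \<Rightarrow> bool" where
  "touches_axis_inside w \<longleftrightarrow> (\<exists>i. 0 < i \<and> i < length w \<and> height (take i w) = 0)"

text \<open>Standard Young tableaux of the two-row shape \<open>(a, b)\<close>, as pairs of a top and a bottom row.
  The notion is only meant for \<open>b \<le> a\<close>.\<close>

definition two_row_SYT :: "nat \<Rightarrow> nat \<Rightarrow> (nat list \<times> nat list) set" where
  "two_row_SYT a b = {(t, u). length t = a \<and> length u = b \<and>
     distinct (t @ u) \<and> set (t @ u) = {1..a + b} \<and>
     sorted_wrt (<) t \<and> sorted_wrt (<) u \<and> (\<forall>j<b. t ! j < u ! j)}"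

end

(* Cutting at the first return to the axis (when k \<ge> 1), a path of the class is uniquely
   U^k A D B D^p, where A runs from height k to height 1 without going below 1 and B is a ballot
   path from 0 to p. Traversing A backwards gives a ballot path A' from 0 to k - 1, and A' U B is an
   arbitrary ballot path from 0 to k + p, cut at its last passage from k - 1 to k.
   When k = 0 the path is B D^p with B a ballot path from 0 to p. Ballot paths
   with n upsteps and n - d downsteps encode the tableaux: the two rows list the positions of the
   upsteps and of the downsteps. *)
theory Submission imports Defs begin

section \<open>Heights and nonnegativity of paths started at an arbitrary height\<close>

section \<open>Ballot paths\<close>

text \<open>The starting height is a parameter so that a path can be cut anywhere and each piece
  judged at its own level. Both end heights are tested.\<close>

fun nonneg_from :: "int \<Rightarrow> path \<Rightarrow> bool" where
  "nonneg_from h [] \<longleftrightarrow> 0 \<le> h"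
| "nonneg_from h (s # w) \<longleftrightarrow> 0 \<le> h \<and> nonneg_from (h + rise s) w"

lemma height_Nil [simp]: "height [] = 0"
  by (simp add: height_def)

lemma height_Cons [simp]: "height (s # w) = rise s + height w"
  by (simp add: height_def)

lemma height_append [simp]: "height (v @ w) = height v + height w"
  by (simp add: height_def)

lemma height_replicate_Up [simp]: "height (replicate k Up) = int k"
  by (induction k) auto

lemma height_replicate_Down [simp]: "height (replicate k Down) = - int k"
  by (induction k) auto

lemma nonneg_from_start: "nonneg_from h w \<Longrightarrow> 0 \<le> h"
  by (cases w) auto

lemma nonneg_from_append [simp]:
  "nonneg_from h (v @ w) \<longleftrightarrow> nonneg_from h v \<and> nonneg_from (h + height v) w"
  by (induction h v rule: nonneg_from.induct) (auto simp: add.assoc dest: nonneg_from_start)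

lemma nonneg_from_mono: "nonneg_from h w \<Longrightarrow> h \<le> h' \<Longrightarrow> nonneg_from h' w"
proof (induction w arbitrary: h h')
  case (Cons s w)
  show ?case using Cons.prems Cons.IH[of "h + rise s" "h' + rise s"] by simp
qed simp

lemma nonneg_from_replicate_Up [simp]: "nonneg_from h (replicate k Up) \<longleftrightarrow> 0 \<le> h"
proof (induction k arbitrary: h)
  case (Suc k)
  show ?case using Suc.IH[of "h + 1"] by auto
qed simp

lemma nonneg_from_replicate_Down [simp]: "nonneg_from h (replicate k Down) \<longleftrightarrow> int k \<le> h"
  by (induction k arbitrary: h) auto

lemma nonneg_from_iff_take:
  "nonneg_from h w \<longleftrightarrow> (\<forall>i\<le>length w. 0 \<le> h + height (take i w))"
proof (induction w arbitrary: h)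
  case Nil
  then show ?case by simp
next
  case (Cons s w)
  have "(\<forall>i\<le>length (s # w). 0 \<le> h + height (take i (s # w))) \<longleftrightarrow>
      0 \<le> h \<and> (\<forall>i\<le>length w. 0 \<le> h + rise s + height (take i w))"
    by (simp add: All_less_Suc2 add.assoc flip: less_Suc_eq_le)
  then show ?case by (simp add: Cons.IH)
qed

lemma dyck_iff: "dyck w \<longleftrightarrow> nonneg_from 0 w \<and> height w = 0"
  by (simp add: dyck_def nonneg_from_iff_take)

lemma dyck_Nil [simp]: "dyck []"
  by (simp add: dyck_iff)

lemma dyck_append: "dyck v \<Longrightarrow> dyck w \<Longrightarrow> dyck (v @ w)"
  by (simp add: dyck_iff)

lemma dyck_concat: "\<forall>c\<in>set cs. dyck c \<Longrightarrow> dyck (concat cs)"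
  by (induction cs) (auto intro: dyck_append)

lemma abs_height_le: "\<bar>height w\<bar> \<le> int (length w)"
proof (induction w)
  case (Cons s w)
  then show ?case by (cases s) auto
qed auto

section \<open>Reversal of paths\<close>

fun flip_step :: "step \<Rightarrow> step" where
  "flip_step Up = Down"
| "flip_step Down = Up"

text \<open>Reflection in a vertical line: reading a path backwards also exchanges upsteps and
  downsteps.\<close>

definition mirror :: "path \<Rightarrow> path" where
  "mirror w = rev (map flip_step w)"

lemma flip_flip [simp]: "flip_step (flip_step s) = s"
  by (cases s) auto

lemma rise_flip [simp]: "rise (flip_step s) = - rise s"
  by (cases s) auto

lemma mirror_mirror [simp]: "mirror (mirror w) = w"
  by (simp add: mirror_def rev_map o_def)

lemma mirror_simps [simp]:
  "mirror [] = []" "mirror (s # w) = mirror w @ [flip_step s]"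
  "mirror (v @ w) = mirror w @ mirror v" "length (mirror w) = length w"
  by (simp_all add: mirror_def)

lemma height_mirror [simp]: "height (mirror w) = - height w"
  by (induction w) auto

text \<open>The mirrored path, started at the final height, visits the same heights in reverse
  order.\<close>

lemma nonneg_from_mirror: "nonneg_from (h + height w) (mirror w) \<longleftrightarrow> nonneg_from h w"
proof (induction w arbitrary: h)
  case (Cons s w)
  then show ?case
    using nonneg_from_start[of "h + rise s" w] by (simp flip: add.assoc) blast
qed auto

section \<open>Existence and uniqueness of cuts at a level crossing\<close>

section \<open>First and last passages\<close>

text \<open>Steps change the height by one, so the first step to a negative height is a downstep
  leaving from height 0.\<close>

lemma first_passage:
  assumes "0 \<le> h" "h + height w < 0"
  obtains x y where "w = x @ Down # y" "nonneg_from h x" "h + height x = 0"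
  using assms
proof (induction w arbitrary: h thesis)
  case Nil
  then show ?case by simp
next
  case (Cons s w)
  show ?case
  proof (cases "h + rise s < 0")
    case True
    then have "s = Down" "h = 0" using Cons.prems by (cases s; simp)+
    then show ?thesis using Cons.prems(1)[of "[]" w] by simp
  next
    case False
    then obtain x y where "w = x @ Down # y" "nonneg_from (h + rise s) x" "h + rise s + height x = 0"
      using Cons.IH[of "h + rise s"] Cons.prems by (auto simp: add.assoc)
    then show ?thesis using Cons.prems(1)[of "s # x" y] Cons.prems by simp
  qed
qed

lemma first_passage_unique:
  assumes "x @ Down # y = x' @ Down # y'"
    and "nonneg_from h x" "h + height x = 0" "nonneg_from h x'" "h + height x' = 0"
  shows "x = x' \<and> y = y'"
proof -
  \<comment> \<open>If one of \<open>x\<close>, \<open>x'\<close> properly extended the other, its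
    extra part would begin with \<open>Down\<close> at height 0 and so violate
    nonnegativity.\<close>
  have "u = []" if "v = z @ u" "u @ Down # r = Down # r'" "nonneg_from h v" "h + height z = 0"
    for u v z r r'
    using that by (cases u) (auto dest: nonneg_from_start)
  then show ?thesis
    using assms unfolding append_eq_append_conv2 by (metis append_Nil append_Nil2 list.inject)
qed

text \<open>The last upstep from \<open>h\<close> to \<open>h + 1\<close> is the first downstep
  below level \<open>h + 1\<close> when the path is read backwards.\<close>

lemma last_passage:
  assumes "0 \<le> h" "h < height w" "nonneg_from 0 w"
  obtains x y where "w = x @ Up # y" "nonneg_from 0 x" "height x = h" "nonneg_from 0 y"
proof -
  \<comment> \<open>Heights are measured from level \<open>h + 1\<close>, so the mirror starts at
    \<open>height w - h - 1\<close>.\<close>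
  obtain x y where xy: "mirror w = x @ Down # y" "nonneg_from (height w - h - 1) x"
      "height w - h - 1 + height x = 0"
    using first_passage[of "height w - h - 1" "mirror w"] assms by auto
  have w: "w = mirror y @ Up # mirror x"
    using arg_cong[OF xy(1), of mirror] by simp
  have "nonneg_from 0 (mirror x)"
    using xy nonneg_from_mirror[of "height w - h - 1" x] by simp
  moreover have "height (mirror y) = h" using arg_cong[OF w, of height] xy(3) by simp
  ultimately show thesis using that[OF w] assms(3) w by simp
qed

text \<open>If one cut came strictly later, the rest after the earlier cut would have to come back
  below its own starting height.\<close>

lemma last_passage_unique:
  assumes "x @ Up # y = x' @ Up # y'"
    and "height x = height x'" "nonneg_from 0 y" "nonneg_from 0 y'"
  shows "x = x' \<and> y = y'"
proof -
  have "u = []" if "u @ Up # r = Up # r'" "nonneg_from 0 r'" "height u = 0" for u r r'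
    using that by (cases u) (auto dest: nonneg_from_start)
  then show ?thesis
    using assms unfolding append_eq_append_conv2
    by (metis append_Nil append_Nil2 list.inject height_append add_cancel_right_right)
qed

section \<open>Normal form with exactly two components\<close>

section \<open>Splitting paths of the class\<close>

text \<open>Otherwise \<open>c\<close> would consist of upsteps only, which is impossible for a
  nonempty path ending at height 0.\<close>

lemma prefix_Up_dyck_append:
  assumes "dyck c" "c \<noteq> []" "prefix (replicate k Up) (c @ c')"
  shows "prefix (replicate k Up) c"
proof -
  have False if "replicate k Up = c @ us" for us
  proof -
    from that have "c = replicate (length c) Up"
      by (metis append_eq_conv_conj take_replicate length_take length_replicate)
    then show False using assms(1,2) by (metis dyck_iff height_replicate_Up length_0_conv of_nat_eq_0_iff)
  qed
  then show ?thesis using assms(3) by (auto simp: prefix_append)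
qed

lemma suffix_Down_dyck_append:
  assumes "dyck c" "c \<noteq> []" "suffix (replicate p Down) (c' @ c)"
  shows "suffix (replicate p Down) c"
proof -
  have False if "replicate p Down = us @ c" for us
  proof -
    from that have "c = replicate (length c) Down"
      by (metis append_eq_conv_conj drop_replicate length_drop length_replicate)
    then show False using assms(1,2) by (metis dyck_iff height_replicate_Down length_0_conv neg_equal_0_iff_equal of_nat_eq_0_iff)
  qed
  then show ?thesis using assms(3) by (auto simp: suffix_append)
qed

text \<open>The part after the initial run must descend \<open>k\<close> levels, so it has at least
  \<open>k\<close> steps.\<close>

lemma semilength_ge_prefix:
  assumes "dyck c" "prefix (replicate k Up) c"
  shows "k \<le> semilength c"
proof -
  obtain v where v: "c = replicate k Up @ v" using assms(2) by (auto simp: prefix_def)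
  have "int k \<le> int (length v)" using abs_height_le[of v] assms(1) v by (simp add: dyck_iff)
  then show ?thesis using v by (simp add: semilength_def)
qed

lemma semilength_ge_suffix:
  assumes "dyck c" "suffix (replicate p Down) c"
  shows "p \<le> semilength c"
proof -
  obtain v where v: "c = v @ replicate p Down" using assms(2) by (auto simp: suffix_def)
  have "int p \<le> int (length v)" using abs_height_le[of v] assms(1) v by (simp add: dyck_iff)
  then show ?thesis using v by (simp add: semilength_def)
qed

lemma concat_nonempty: "i < length cs \<Longrightarrow> cs ! i \<noteq> [] \<Longrightarrow> concat cs \<noteq> []"
  by (auto simp: concat_eq_Nil_conv)

text \<open>Two components suffice, the first carrying the initial run and the second the final run.
  If \<open>k\<close> or \<open>p\<close> is 0, one of them can be taken empty.\<close>

lemma D_class_split: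
  assumes "w \<in> D_class k p"
  obtains c c' where "w = c @ c'" "dyck c" "dyck c'"
    "prefix (replicate k Up) c" "suffix (replicate p Down) c'"
    "1 \<le> k \<Longrightarrow> 1 \<le> p \<Longrightarrow> c \<noteq> [] \<and> c' \<noteq> []"
proof -
  have w: "dyck w" "prefix (replicate k Up) w" "suffix (replicate p Down) w"
    using assms by (auto simp: D_class_def P_class_def)
  consider "k = 0" | "p = 0" | "1 \<le> k" "1 \<le> p" by linarith
  then show thesis
  proof cases
    case 1
    then show ?thesis using that[of "[]" w] w by simp
  next
    case 2
    then show ?thesis using that[of w "[]"] w by simp
  next
    case 3
    from assms obtain cs i j where cs: "\<forall>c\<in>set cs. dyck c" "w = concat cs"
        "i < length cs" "j < length cs" "i \<noteq> j" "k \<le> semilength (cs ! i)" "p \<le> semilength (cs ! j)"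
      by (auto simp: D_class_def)
    \<comment> \<open>The two long components may occur in either order. What matters is that both
      are nonempty: cutting just before the later one leaves a nonempty path on each side.\<close>
    define a b where "a = min i j" and "b = max i j"
    have ab: "a < b" "b < length cs" using cs unfolding a_def b_def by auto
    have "cs ! i \<noteq> []" "cs ! j \<noteq> []" using cs 3 by (auto simp: semilength_def)
    then have ne: "cs ! a \<noteq> []" "cs ! b \<noteq> []" unfolding a_def b_def by (auto simp: min_def max_def)
    define c c' where "c = concat (take b cs)" and "c' = concat (drop b cs)"
    have wc: "w = c @ c'" unfolding c_def c'_def cs(2) by (metis append_take_drop_id concat_append)
    have d: "dyck c" "dyck c'" unfolding c_def c'_def
      using cs(1) by (auto intro!: dyck_concat dest: in_set_takeD in_set_dropD)
    have "c \<noteq> []" unfolding c_def using concat_nonempty[of a "take b cs"] ab ne by simp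
    moreover have "c' \<noteq> []" unfolding c'_def using concat_nonempty[of 0 "drop b cs"] ab ne by simp
    ultimately show ?thesis
      using that[OF wc d] w wc d prefix_Up_dyck_append suffix_Down_dyck_append by blast
  qed
qed

text \<open>The runs already force the two components to be long enough.\<close>

lemma D_classI:
  assumes "dyck c" "dyck c'" "prefix (replicate k Up) c" "suffix (replicate p Down) c'"
  shows "c @ c' \<in> D_class k p"
proof -
  have "c @ c' \<in> P_class k p"
    using assms by (simp add: P_class_def dyck_append suffix_appendI)
  moreover have "k \<le> semilength c" "p \<le> semilength c'"
    using assms by (simp_all add: semilength_ge_prefix semilength_ge_suffix)
  then have "\<exists>i<length [c, c']. \<exists>j<length [c, c']. i \<noteq> j \<and>
      k \<le> semilength ([c, c'] ! i) \<and> p \<le> semilength ([c, c'] ! j)"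
    by (intro exI[of _ 0] exI[of _ "Suc 0"] conjI) simp_all
  ultimately show ?thesis
    unfolding D_class_def using assms(1,2) by (intro CollectI conjI exI[of _ "[c, c']"]) auto
qed

text \<open>For positive \<open>k\<close> and \<open>p\<close> both components are nonempty, so
  their junction is an interior touch; conversely, any interior touch is a cut into two nonempty
  Dyck paths.\<close>

lemma D_class_touching:
  assumes "1 \<le> k" "1 \<le> p"
  shows "D_class k p = {w \<in> P_class k p. touches_axis_inside w}"
proof (intro equalityI subsetI)
  fix w assume w: "w \<in> D_class k p"
  then obtain c c' where c: "w = c @ c'" "dyck c" "c \<noteq> []" "c' \<noteq> []"
    using assms by (elim D_class_split) auto
  then have "touches_axis_inside w"
    unfolding touches_axis_inside_def by (intro exI[of _ "length c"]) (simp add: dyck_iff)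
  then show "w \<in> {w \<in> P_class k p. touches_axis_inside w}"
    using w by (simp add: D_class_def)
next
  fix w assume "w \<in> {w \<in> P_class k p. touches_axis_inside w}"
  then obtain i where w: "dyck w" "prefix (replicate k Up) w" "suffix (replicate p Down) w"
    and i: "0 < i" "i < length w" "height (take i w) = 0"
    by (auto simp: P_class_def touches_axis_inside_def)
  define c c' where "c = take i w" and "c' = drop i w"
  have wc: "w = c @ c'" by (simp add: c_def c'_def)
  have ne: "c \<noteq> []" "c' \<noteq> []" using i by (auto simp: c_def c'_def)
  have "height c = 0" using i(3) by (simp add: c_def)
  then have d: "dyck c" "dyck c'" using w(1) unfolding wc by (auto simp: dyck_iff)
  show "w \<in> D_class k p"
    using w d ne prefix_Up_dyck_append suffix_Down_dyck_append D_classI unfolding wc by blast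
qed

section \<open>Bijection by reversing the part before the first return\<close>

section \<open>From the class to ballot paths\<close>

definition ballot_paths :: "nat \<Rightarrow> nat \<Rightarrow> path set" where
  "ballot_paths m h = {w. nonneg_from 0 w \<and> height w = int h \<and> length w = m}"

text \<open>With an empty first component, only the final run is a condition; deleting it leaves an
  arbitrary ballot path ending at height \<open>p\<close>.\<close>

lemma card_D_class_0:
  assumes "p \<le> n"
  shows "card {w \<in> D_class 0 p. semilength w = n} = card (ballot_paths (2 * n - p) p)"
proof -
  have "{w \<in> D_class 0 p. semilength w = n} = (\<lambda>q. q @ replicate p Down) ` ballot_paths (2 * n - p) p"
  proof (intro equalityI subsetI)
    fix w assume "w \<in> {w \<in> D_class 0 p. semilength w = n}"
    then have w: "dyck w" "suffix (replicate p Down) w" "length w = 2 * n"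
      by (auto simp: D_class_def P_class_def length_dyck)
    then obtain q where "w = q @ replicate p Down" by (auto simp: suffix_def)
    then show "w \<in> (\<lambda>q. q @ replicate p Down) ` ballot_paths (2 * n - p) p"
      using w by (auto simp: ballot_paths_def dyck_iff)
  next
    fix w assume "w \<in> (\<lambda>q. q @ replicate p Down) ` ballot_paths (2 * n - p) p"
    then obtain q where "w = q @ replicate p Down" "q \<in> ballot_paths (2 * n - p) p" by blast
    then show "w \<in> {w \<in> D_class 0 p. semilength w = n}"
      using D_classI[of "[]" w 0 p] assms
      by (auto simp: ballot_paths_def dyck_iff semilength_def suffix_def)
  qed
  then show ?thesis by (simp add: card_image inj_on_def)
qed

text \<open>The two sides of the last passage from height \<open>k\<close> to \<open>k + 1\<close>;
  the summand 1 counts the upstep between them.\<close>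

definition passage_pairs :: "nat \<Rightarrow> nat \<Rightarrow> nat \<Rightarrow> (path \<times> path) set" where
  "passage_pairs m k p = {(x, y). nonneg_from 0 x \<and> height x = int k \<and>
     nonneg_from 0 y \<and> height y = int p \<and> length x + 1 + length y = m}"

lemma card_passage_pairs:
  "card (passage_pairs m k p) = card (ballot_paths m (Suc k + p))"
proof (rule bij_betw_same_card[of "\<lambda>(x, y). x @ Up # y"], rule bij_betw_imageI)
  show "inj_on (\<lambda>(x, y). x @ Up # y) (passage_pairs m k p)"
    by (auto simp: inj_on_def passage_pairs_def dest: last_passage_unique)
  show "(\<lambda>(x, y). x @ Up # y) ` passage_pairs m k p = ballot_paths m (Suc k + p)"
  proof (intro equalityI subsetI)
    fix w assume "w \<in> (\<lambda>(x, y). x @ Up # y) ` passage_pairs m k p"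
    then show "w \<in> ballot_paths m (Suc k + p)"
      \<comment> \<open>The second piece is nonnegative from 0, hence also from the height
        \<open>k + 1\<close> where it is placed.\<close>
      using nonneg_from_mono[of 0 _ "int k + 1"] by (auto simp: passage_pairs_def ballot_paths_def)
  next
    fix w assume w: "w \<in> ballot_paths m (Suc k + p)"
    then obtain x y where "w = x @ Up # y" "nonneg_from 0 x" "height x = int k" "nonneg_from 0 y"
      using last_passage[of "int k" w] by (auto simp: ballot_paths_def)
    then show "w \<in> (\<lambda>(x, y). x @ Up # y) ` passage_pairs m k p"
      using w by (intro image_eqI[of _ _ "(x, y)"]) (auto simp: passage_pairs_def ballot_paths_def)
  qed
qed

text \<open>The first piece of a pair, reversed, becomes the stretch from the initial run to the
  step of first return. Both sets thus share the same data, glued differently.\<close>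

lemma card_D_class_Suc:
  assumes "Suc k + p \<le> n"
  shows "card {w \<in> D_class (Suc k) p. semilength w = n} =
    card (passage_pairs (2 * n - (Suc k + p)) k p)"
proof (rule sym, rule bij_betw_same_card, rule bij_betw_imageI)
  \<comment> \<open>After the initial run at height \<open>k + 1\<close>, \<open>mirror x\<close>
    descends to height 1 without going below 1, so the displayed \<open>Down\<close> is the first
    return to the axis.\<close>
  let ?f = "\<lambda>(x, y). replicate (Suc k) Up @ mirror x @ Down # y @ replicate p Down"
  let ?X = "passage_pairs (2 * n - (Suc k + p)) k p"
  have mirror_nonneg: "nonneg_from (int k) (mirror x)" if "nonneg_from 0 x" "height x = int k" for x
    using that nonneg_from_mirror[of 0 x] by simp
  show "inj_on ?f ?X"
  proof (rule inj_onI)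
    fix q q' assume q: "q \<in> ?X" "q' \<in> ?X" "?f q = ?f q'"
    obtain x y x' y' where xy: "q = (x, y)" "q' = (x', y')" by (cases q, cases q')
    have "nonneg_from (int k) (mirror x)" "int k + height (mirror x) = 0"
      "nonneg_from (int k) (mirror x')" "int k + height (mirror x') = 0"
      using q xy by (auto simp: passage_pairs_def mirror_nonneg)
    then have "mirror x = mirror x' \<and> y @ replicate p Down = y' @ replicate p Down"
      using q(3) xy by (intro first_passage_unique) auto
    then show "q = q'" using xy by (metis mirror_mirror append_same_eq)
  qed
  show "?f ` ?X = {w \<in> D_class (Suc k) p. semilength w = n}"
  proof (intro equalityI subsetI)
    fix w assume "w \<in> ?f ` ?X"
    then obtain x y where xy: "(x, y) \<in> ?X" and w: "w = ?f (x, y)" by (elim imageE) (auto simp del: replicate_Suc)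
    define c c' where "c = replicate (Suc k) Up @ mirror x @ [Down]" and "c' = y @ replicate p Down"
    have "nonneg_from (int k) (mirror x)"
      using xy by (simp add: passage_pairs_def mirror_nonneg)
    then have "dyck c"
      using xy unfolding c_def
      by (auto simp: dyck_iff passage_pairs_def elim: nonneg_from_mono simp del: replicate_Suc)
    moreover have "dyck c'" using xy by (auto simp: c'_def dyck_iff passage_pairs_def)
    ultimately have "c @ c' \<in> D_class (Suc k) p"
      by (rule D_classI) (auto simp: c_def c'_def suffix_def)
    then show "w \<in> {w \<in> D_class (Suc k) p. semilength w = n}"
      using xy assms by (auto simp: c_def c'_def w passage_pairs_def semilength_def)
  next
    fix w assume w: "w \<in> {w \<in> D_class (Suc k) p. semilength w = n}"
    then obtain c c' where c: "w = c @ c'" "dyck c" "dyck c'"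
        "prefix (replicate (Suc k) Up) c" "suffix (replicate p Down) c'"
      by (blast elim: D_class_split)
    from c obtain v z where v: "c = replicate (Suc k) Up @ v" and z: "c' = z @ replicate p Down"
      by (auto simp: prefix_def suffix_def)
    have "int k + height v < 0" using c(2) v by (simp add: dyck_iff)
    \<comment> \<open>Heights are measured from level 1, hence the start at \<open>int k\<close>:
      dropping below 0 on this scale means returning to the axis.\<close>
    then obtain x y where xy: "v = x @ Down # y" "nonneg_from (int k) x" "int k + height x = 0"
      using first_passage[of "int k" v] by auto
    have "nonneg_from 0 (mirror x)"
      using nonneg_from_mirror[of "int k" x] xy by simp
    moreover have "nonneg_from 0 y \<and> height y = 0"
    proof -
      have "int (Suc k) + height x - 1 = 0" using xy(3) by simp
      then show ?thesis using c(2) unfolding v xy(1) dyck_iff by (auto simp del: replicate_Suc)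
    qed
    moreover have "nonneg_from 0 z" "height z = int p"
      using c(3) by (simp_all add: z dyck_iff)
    moreover have "length w = 2 * n"
      using w by (auto simp: D_class_def P_class_def length_dyck)
    \<comment> \<open>The component \<open>c\<close> may go on after its first return; that
      remainder \<open>y\<close> joins the second piece.\<close>
    ultimately have "(mirror x, y @ z) \<in> ?X"
      using xy(3) by (auto simp: passage_pairs_def c(1) v z xy(1))
    moreover have "w = ?f (mirror x, y @ z)"
      by (simp add: c(1) v z xy(1))
    ultimately show "w \<in> ?f ` ?X" by blast
  qed
qed

lemma card_D_class:
  assumes "k + p \<le> n"
  shows "card {w \<in> D_class k p. semilength w = n} = card (ballot_paths (2 * n - (k + p)) (k + p))"
proof (cases k)
  case 0
  then show ?thesis using card_D_class_0 assms by simp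
next
  case (Suc k')
  then show ?thesis
    using card_D_class_Suc[of k' p n] card_passage_pairs[of "2 * n - (k + p)" k' p] assms by simp
qed

section \<open>Rows of a tableau as positions of upsteps and downsteps\<close>

section \<open>From ballot paths to tableaux\<close>

text \<open>Positions are counted from 1 to match the tableau entries, whence the index
  \<open>i - 1\<close>.\<close>

definition positions :: "step \<Rightarrow> path \<Rightarrow> nat list" where
  "positions s w = filter (\<lambda>i. w ! (i - 1) = s) [1..<Suc (length w)]"

lemma positions_Nil [simp]: "positions s [] = []"
  by (simp add: positions_def)

lemma positions_snoc [simp]:
  "positions s (w @ [r]) = positions s w @ (if r = s then [Suc (length w)] else [])"
proof -
  have "filter (\<lambda>i. (w @ [r]) ! (i - 1) = s) [1..<Suc (length w)] = positions s w"
    unfolding positions_def by (rule filter_cong) (auto simp: nth_append)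
  then show ?thesis by (simp add: positions_def)
qed

lemma set_positions: "set (positions s w) = {i \<in> {1..length w}. w ! (i - 1) = s}"
  by (auto simp: positions_def)

lemma sorted_positions: "sorted_wrt (<) (positions s w)"
  unfolding positions_def by (intro sorted_wrt_filter sorted_wrt_upt)

lemma length_positions: "length (positions s w) = count_list w s"
  by (induction w rule: rev_induct) auto

lemma length_filter_positions:
  "i \<le> length w \<Longrightarrow> length (filter (\<lambda>x. x \<le> i) (positions s w)) = count_list (take i w) s"
proof (induction w rule: rev_induct)
  case (snoc r w)
  show ?case
  proof (cases "i \<le> length w")
    case True
    then show ?thesis using snoc by simp
  next
    case False
    then have i: "i = length (w @ [r])" using snoc.prems by simp
    have "filter (\<lambda>x. x \<le> i) (positions s (w @ [r])) = positions s (w @ [r])"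
      unfolding i by (rule filter_True) (auto simp: set_positions)
    then show ?thesis by (simp add: i length_positions del: positions_snoc)
  qed
qed simp

lemma height_count: "height w = int (count_list w Up) - int (count_list w Down)"
proof (induction w)
  case (Cons s w)
  then show ?case by (cases s) auto
qed simp

lemma length_count: "length w = count_list w Up + count_list w Down"
proof (induction w)
  case (Cons s w)
  then show ?case by (cases s) auto
qed simp

text \<open>In an increasing list the entries that are at most \<open>i\<close> form an initial
  segment.\<close>

lemma nth_le_iff_length_filter:
  fixes t :: "nat list"
  assumes "sorted_wrt (<) t" "j < length t"
  shows "t ! j \<le> i \<longleftrightarrow> j < length (filter (\<lambda>x. x \<le> i) t)"
  using assms
proof (induction t arbitrary: j)
  case (Cons a t)
  show ?case
  proof (cases "a \<le> i")
    case True
    then show ?thesis using Cons by (cases j) auto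
  next
    case False
    then have "\<forall>x\<in>set (a # t). \<not> x \<le> i" using Cons.prems(1) by auto
    moreover from this have "filter (\<lambda>x. x \<le> i) (a # t) = []" by (simp only: filter_False)
    ultimately show ?thesis using Cons.prems(2) nth_mem by (metis list.size(3) not_less0)
  qed
qed simp

text \<open>This turns the column condition into the ballot condition: among the numbers up to any
  \<open>i\<close>, the bottom row never holds more than the top row.\<close>

lemma columns_increasing_iff:
  fixes t u :: "nat list"
  assumes "sorted_wrt (<) t" "sorted_wrt (<) u" "set t \<inter> set u = {}" "length u \<le> length t"
    and "set u \<subseteq> {..m}"
  shows "(\<forall>j<length u. t ! j < u ! j) \<longleftrightarrow>
    (\<forall>i\<le>m. length (filter (\<lambda>x. x \<le> i) u) \<le> length (filter (\<lambda>x. x \<le> i) t))"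
    (is "_ \<longleftrightarrow> (\<forall>i\<le>m. ?U i \<le> ?T i)")
proof (intro iffI allI impI)
  fix i assume cols: "\<forall>j<length u. t ! j < u ! j"
  show "?U i \<le> ?T i"
  proof (rule ccontr)
    assume lt: "\<not> ?U i \<le> ?T i"
    moreover have "?U i \<le> length u" by simp
    \<comment> \<open>Column \<open>?T i\<close> (counted from 0) is the first whose top entry
      exceeds \<open>i\<close>, while its bottom entry is still at most \<open>i\<close>.\<close>
    ultimately have j: "?T i < length u" by linarith
    have "u ! ?T i \<le> i" using nth_le_iff_length_filter[OF assms(2) j] lt by simp
    then have "t ! ?T i \<le> i" using cols j by (meson less_le_trans less_imp_le)
    then show False
      using nth_le_iff_length_filter[OF assms(1), of "?T i" i] j assms(4) by simp
  qed
next
  fix j assume le: "\<forall>i\<le>m. ?U i \<le> ?T i" and j: "j < length u"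
  have "u ! j \<le> m" using assms(5) j nth_mem by (metis atMost_iff subsetD)
  \<comment> \<open>The counts are compared at the bottom entry \<open>u ! j\<close> itself;
    disjointness of the rows then makes the inequality strict.\<close>
  moreover have "j < ?U (u ! j)" using nth_le_iff_length_filter[OF assms(2) j] by blast
  ultimately have "j < ?T (u ! j)" using le less_le_trans by blast
  then have "t ! j \<le> u ! j" using nth_le_iff_length_filter[OF assms(1)] j assms(4) by simp
  moreover have "t ! j \<noteq> u ! j"
    using assms(3,4) j nth_mem by (metis disjoint_iff less_le_trans)
  ultimately show "t ! j < u ! j" by simp
qed

lemma positions_columns_iff:
  assumes "count_list w Down \<le> count_list w Up"
  shows "(\<forall>j<count_list w Down. positions Up w ! j < positions Down w ! j) \<longleftrightarrow> nonneg_from 0 w"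
proof -
  have "(\<forall>j<length (positions Down w). positions Up w ! j < positions Down w ! j) \<longleftrightarrow>
    (\<forall>i\<le>length w. length (filter (\<lambda>x. x \<le> i) (positions Down w)) \<le>
      length (filter (\<lambda>x. x \<le> i) (positions Up w)))"
    using assms
    by (intro columns_increasing_iff) (auto simp: sorted_positions set_positions length_positions)
  then show ?thesis
    by (simp add: length_positions length_filter_positions nonneg_from_iff_take height_count)
qed

lemma card_two_row_SYT:
  assumes "b \<le> a"
  shows "card (ballot_paths (a + b) (a - b)) = card (two_row_SYT a b)"
proof (rule bij_betw_same_card, rule bij_betw_imageI)
  let ?f = "\<lambda>w. (positions Up w, positions Down w)"
  \<comment> \<open>Length \<open>a + b\<close> and final height \<open>a - b\<close> are the sum
    and the difference of the two step counts.\<close>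
  have counts: "count_list w Up = a \<and> count_list w Down = b" if "w \<in> ballot_paths (a + b) (a - b)" for w
    using that assms length_count[of w] height_count[of w] by (auto simp: ballot_paths_def of_nat_diff)
  show "inj_on ?f (ballot_paths (a + b) (a - b))"
  proof (rule inj_onI)
    fix w w' assume ww: "w \<in> ballot_paths (a + b) (a - b)" "w' \<in> ballot_paths (a + b) (a - b)"
      and "?f w = ?f w'"
    then have *: "length w = length w'" "set (positions Up w) = set (positions Up w')"
      by (auto simp: ballot_paths_def)
    have "w ! i = w' ! i" if "i < length w" for i
    proof -
      have "Suc i \<in> set (positions Up w) \<longleftrightarrow> Suc i \<in> set (positions Up w')" using * by simp
      then have "w ! i = Up \<longleftrightarrow> w' ! i = Up" using that * by (simp add: set_positions)
      then show ?thesis by (metis step.exhaust)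
    qed
    then show "w = w'" using * by (simp add: nth_equalityI)
  qed
  show "?f ` ballot_paths (a + b) (a - b) = two_row_SYT a b"
  proof (intro equalityI subsetI)
    fix tu assume "tu \<in> ?f ` ballot_paths (a + b) (a - b)"
    then obtain w where w: "w \<in> ballot_paths (a + b) (a - b)" and tu: "tu = ?f w" by blast
    have "set (positions Up w) \<union> set (positions Down w) = {1..a + b}"
    proof -
      have "w ! i = Up \<or> w ! i = Down" for i by (cases "w ! i") auto
      then show ?thesis using w by (auto simp: set_positions ballot_paths_def)
    qed
    moreover have "set (positions Up w) \<inter> set (positions Down w) = {}"
      by (auto simp: set_positions)
    moreover have "distinct (positions s w)" for s by (simp add: positions_def)
    moreover have "nonneg_from 0 w" using w by (simp add: ballot_paths_def)
    ultimately show "tu \<in> two_row_SYT a b"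
      using counts[OF w] positions_columns_iff[of w] assms
      by (simp add: tu two_row_SYT_def length_positions sorted_positions)
  next
    fix tu assume "tu \<in> two_row_SYT a b"
    then obtain t u where tu: "tu = (t, u)" "length t = a" "length u = b" "distinct (t @ u)"
        "set (t @ u) = {1..a + b}" "sorted_wrt (<) t" "sorted_wrt (<) u" "\<forall>j<b. t ! j < u ! j"
      by (auto simp: two_row_SYT_def)
    \<comment> \<open>Step index \<open>i\<close> corresponds to the tableau entry
      \<open>Suc i\<close>.\<close>
    define w where "w = map (\<lambda>i. if Suc i \<in> set t then Up else Down) [0..<a + b]"
    have len: "length w = a + b" by (simp add: w_def)
    have "set (positions Up w) = set t"
    proof -
      have "i \<in> set (positions Up w) \<longleftrightarrow> i \<in> {1..a + b} \<and> i \<in> set t" for i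
        by (cases i) (auto simp: set_positions len w_def split: if_splits)
      then show ?thesis using tu(5) by auto
    qed
    \<comment> \<open>A strictly increasing list is determined by its set.\<close>
    then have t: "positions Up w = t"
      by (intro strict_sorted_equal sorted_positions tu(6))
    have "set (positions Down w) = set u"
    proof -
      have "i \<in> set (positions Down w) \<longleftrightarrow> i \<in> {1..a + b} \<and> i \<notin> set t" for i
        by (cases i) (auto simp: set_positions len w_def split: if_splits)
      then have "set (positions Down w) = {1..a + b} - set t" by blast
      also have "\<dots> = set u" using tu(4) unfolding tu(5)[symmetric] by auto
      finally show ?thesis .
    qed
    then have u: "positions Down w = u"
      by (intro strict_sorted_equal sorted_positions tu(7))
    have c: "count_list w Up = a" "count_list w Down = b"
      using t u tu(2,3) by (simp_all flip: length_positions)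
    then have "nonneg_from 0 w" using positions_columns_iff[of w] t u tu(8) assms by simp
    then have "w \<in> ballot_paths (a + b) (a - b)"
      using c assms len by (simp add: ballot_paths_def height_count of_nat_diff)
    then show "tu \<in> ?f ` ballot_paths (a + b) (a - b)" using t u tu(1) by (intro image_eqI[of _ _ w]) simp_all
  qed
qed

theorem theorem6:
  fixes k p d n :: nat
  assumes "d = k + p" and "d \<le> n"
  shows "card {w \<in> D_class k p. semilength w = n} = card (two_row_SYT n (n - d))
    \<and> (k \<ge> 1 \<and> p \<ge> 1 \<longrightarrow>
        {w \<in> D_class k p. semilength w = n} =
        {w. dyck w \<and> semilength w = n \<and> prefix (replicate k Up) w \<and>
            suffix (replicate p Down) w \<and> touches_axis_inside w})"
proof (intro conjI impI)
  \<comment> \<open>These identities match the shape \<open>(n, n - d)\<close> with ballot paths of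
    length \<open>2 * n - d\<close> and final height \<open>d\<close>.\<close>
  have "n + (n - d) = 2 * n - d" "n - (n - d) = d" using assms(2) by auto
  then show "card {w \<in> D_class k p. semilength w = n} = card (two_row_SYT n (n - d))"
    using card_D_class[of k p n] card_two_row_SYT[of "n - d" n] assms by simp
next
  assume "k \<ge> 1 \<and> p \<ge> 1"
  then show "{w \<in> D_class k p. semilength w = n} =
      {w. dyck w \<and> semilength w = n \<and> prefix (replicate k Up) w \<and>
        suffix (replicate p Down) w \<and> touches_axis_inside w}"
    using D_class_touching[of k p] by (auto simp: P_class_def)
qed

end
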